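(* Let $f(z)=z+\sum_{n=2}^{\infty}a_nz^n$ be analytic in $\mathbb{D}$. If $\sum_{n=2}^{\infty}n|a_n|\leq 1$, then $f\in\mathcal{U}$. The result is sharp, in the sense that the upper bound $1$ in the coefficient condition cannot be replaced by $1+\epsilon$ for any $\epsilon>0$.
   Context: $\mathbb{D}=\{z\in\mathbb{C}:|z|<1\}$. $\mathcal{A}$ is the set of all analytic functions $f$ in $\mathbb{D}$ of the form $f(z)=z+\sum_{n=2}^{\infty}a_nz^n$, $a_n\in\mathbb{C}$. $\mathcal{U}$ is the set of all $f\in\mathcal{A}$ such that $f(z)/z\neq 0$ in $\mathbb{D}$ (the value at $0$ being $1$) and $\left|f'(z)\left(\frac{z}{f(z)}\right)^2-1\right|<1$ for all $z\in\mathbb{D}$. *)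

theory Defs
  imports "HOL-Analysis.Analysis"
begin

abbreviation unit_disc :: "complex set" where
  "unit_disc \<equiv> ball 0 1"

text \<open>
  \<open>normalized_series f a\<close>: \<open>f\<close> is analytic in the unit disc, with
  \<open>f(z) = z + a\<^sub>2 z\<^sup>2 + a\<^sub>3 z\<^sup>3 + \<dots>\<close> there. The values \<open>a 0\<close> and \<open>a 1\<close> are not used,
  and neither are the values of \<open>f\<close> outside the disc.
\<close>
definition normalized_series :: "(complex \<Rightarrow> complex) \<Rightarrow> (nat \<Rightarrow> complex) \<Rightarrow> bool" where
  "normalized_series f a \<longleftrightarrow>
     f analytic_on unit_disc \<and>
     (\<forall>z\<in>unit_disc. (\<lambda>n. a (n + 2) * z ^ (n + 2)) sums (f z - z))"

definition class_A :: "(complex \<Rightarrow> complex) set" where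
  "class_A = {f. \<exists>a. normalized_series f a}"

text \<open>The function \<open>f(z)/z\<close>, with its removable singularity at \<open>0\<close> filled by \<open>f'(0) = 1\<close>.\<close>
definition quot_z :: "(complex \<Rightarrow> complex) \<Rightarrow> complex \<Rightarrow> complex" where
  "quot_z f z = (if z = 0 then 1 else f z / z)"

definition class_U :: "(complex \<Rightarrow> complex) set" where
  "class_U = {f \<in> class_A.
     (\<forall>z\<in>unit_disc. quot_z f z \<noteq> 0) \<and>
     (\<forall>z\<in>unit_disc. norm (deriv f z * (1 / quot_z f z)\<^sup>2 - 1) < 1)}"

text \<open>
  The condition \<open>2 |a\<^sub>2| + 3 |a\<^sub>3| + \<dots> \<le> c\<close>. Convergence has to be required separately,
  since \<open>suminf\<close> is unspecified on divergent series.
\<close>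
definition coeff_sum_le :: "(nat \<Rightarrow> complex) \<Rightarrow> real \<Rightarrow> bool" where
  "coeff_sum_le a c \<longleftrightarrow>
     summable (\<lambda>n. real (n + 2) * norm (a (n + 2))) \<and>
     (\<Sum>n. real (n + 2) * norm (a (n + 2))) \<le> c"

end

theory Submission
  imports Defs
begin

text \<open>
  Write \<open>g(z) = f(z)/z = 1 + h(z)\<close> with \<open>h(z) = \<Sum> a\<^sub>n z\<^sup>n\<^sup>-\<^sup>1\<close>, the sums running over \<open>n \<ge> 2\<close>. The
  condition on \<open>f\<close> is \<open>|f'(z) - g(z)\<^sup>2| < |g(z)|\<^sup>2\<close>, and
  \<open>f'(z) - g(z)\<^sup>2 = \<Sum> (n-2) a\<^sub>n z\<^sup>n\<^sup>-\<^sup>1 - h(z)\<^sup>2\<close>, because the terms that are linear in \<open>h\<close> combine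
  with \<open>f'\<close>. With \<open>r = |z|\<close>, \<open>S = \<Sum> |a\<^sub>n| r\<^sup>n\<^sup>-\<^sup>1\<close> and \<open>T = \<Sum> (n-2) |a\<^sub>n| r\<^sup>n\<^sup>-\<^sup>1\<close> the left-hand side is
  at most \<open>T + S\<^sup>2\<close>, and the right-hand side is at least \<open>(1 - S)\<^sup>2\<close> as soon as \<open>S \<le> 1\<close>. The squares
  \<open>S\<^sup>2\<close> cancel, so it is enough that \<open>T + 2 S < 1\<close>. But \<open>T + 2 S = \<Sum> n |a\<^sub>n| r\<^sup>n\<^sup>-\<^sup>1\<close>, which is at most
  \<open>r \<Sum> n |a\<^sub>n| \<le> r < 1\<close>: the weights \<open>n\<close> of the coefficient condition are exactly what the estimate
  asks for. This is \<open>coeff_sum_le_1_imp_class_U\<close>.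

  The bound is sharp because of \<open>f(z) = z + (1 + \<epsilon>)/2 z\<^sup>2\<close>. Its coefficient sum is \<open>1 + \<epsilon>\<close>, and its
  derivative vanishes at the point \<open>-1/(1 + \<epsilon>)\<close> of the disc. At a zero of \<open>f'\<close> the quantity
  \<open>f'(z) (z/f(z))\<^sup>2 - 1\<close> equals \<open>-1\<close>, so \<open>f\<close> is not in \<open>\<U>\<close>.
\<close>

text \<open>
  The series of \<open>f\<close> may be differentiated term by term; the index \<open>n\<close> stands for the term of
  degree \<open>n + 2\<close> in \<open>f\<close>.
\<close>
lemma normalized_series_deriv_sums:
  assumes f: "normalized_series f a" and z: "z \<in> unit_disc"
  shows "(\<lambda>n. of_nat (n + 2) * a (n + 2) * z ^ (n + 1)) sums (deriv f z - 1)"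
proof -
  define c where "c n = (if n = 0 then 0 else if n = 1 then 1 else a n)" for n
  have c_sums: "(\<lambda>n. c n * w ^ n) sums f w" if "norm w < 1" for w
  proof -
    have "(\<lambda>n. c (n + 2) * w ^ (n + 2)) sums (f w - w)"
      using f that by (simp add: normalized_series_def c_def)
    moreover have "(\<Sum>i<2. c i * w ^ i) = w"
      by (simp add: c_def numeral_2_eq_2)
    ultimately show ?thesis
      using sums_iff_shift' [of "\<lambda>n. c n * w ^ n" 2 "f w"] by simp
  qed
  then have c_summable: "summable (\<lambda>n. c n * w ^ n)" if "norm w < 1" for w
    using that sums_summable by blast
  have nz: "norm z < 1" using z by simp
  have "((\<lambda>w. \<Sum>n. c n * w ^ n) has_field_derivative (\<Sum>n. diffs c n * z ^ n)) (at z)"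
    using c_summable nz by (rule termdiffs_strong')
  then have "(f has_field_derivative (\<Sum>n. diffs c n * z ^ n)) (at z)"
    by (rule has_field_derivative_transform_within_open [OF _ open_ball z])
       (use c_sums in \<open>simp add: sums_iff\<close>)
  then have "deriv f z = (\<Sum>n. diffs c n * z ^ n)"
    by (rule DERIV_imp_deriv)
  moreover have "summable (\<lambda>n. diffs c n * z ^ n)"
    using nz c_summable by (rule termdiff_converges)
  ultimately have "(\<lambda>n. diffs c n * z ^ n) sums deriv f z"
    by (simp add: summable_sums)
  then have "(\<lambda>n. diffs c (Suc n) * z ^ Suc n) sums (deriv f z - 1)"
    using sums_Suc_iff [of "\<lambda>n. diffs c n * z ^ n" "deriv f z - 1"] by (simp add: diffs_def c_def)
  then show ?thesis
    by (simp add: diffs_def c_def)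
qed

text \<open>
  Dividing the series by \<open>z\<close> also gives the right value \<open>1\<close> at \<open>0\<close>, so no case distinction is
  needed afterwards.
\<close>
lemma normalized_series_quot_z_sums:
  assumes f: "normalized_series f a" and z: "z \<in> unit_disc"
  shows "(\<lambda>n. a (n + 2) * z ^ (n + 1)) sums (quot_z f z - 1)"
proof (cases "z = 0")
  case True
  then show ?thesis by (simp add: quot_z_def)
next
  case False
  have "(\<lambda>n. a (n + 2) * z ^ (n + 2)) sums (f z - z)"
    using f z by (simp add: normalized_series_def)
  then have "(\<lambda>n. a (n + 2) * z ^ (n + 2) / z) sums ((f z - z) / z)"
    by (rule sums_divide)
  with False show ?thesis
    by (simp add: quot_z_def diff_divide_distrib)
qed

text \<open>
  Here \<open>d\<close> and \<open>g\<close> stand for \<open>f'(z)\<close> and \<open>f(z)/z\<close>. Only \<open>d + 1 - 2 g\<close> and \<open>g - 1\<close> are bounded,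
  because \<open>d - g\<^sup>2 = (d + 1 - 2 g) - (g - 1)\<^sup>2\<close> makes the two terms \<open>S\<^sup>2\<close> cancel.
\<close>
lemma norm_div_square_minus_1_less_1:
  fixes d g :: "'a :: real_normed_field"
  assumes T: "norm (d + 1 - 2 * g) \<le> T" and S: "norm (g - 1) \<le> S"
    and TS: "T + 2 * S < 1"
  shows "g \<noteq> 0" and "norm (d * (1 / g)\<^sup>2 - 1) < 1"
proof -
  have "0 \<le> T" using T norm_ge_zero order_trans by blast
  then have "S < 1" using TS by linarith
  have g_lower: "1 - S \<le> norm g"
    using norm_triangle_ineq2 [of 1 "1 - g"] S by (simp add: norm_minus_commute)
  then show "g \<noteq> 0" using \<open>S < 1\<close> by auto
  have "norm (d - g\<^sup>2) = norm ((d + 1 - 2 * g) - (g - 1)\<^sup>2)"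
    by (simp add: power2_eq_square algebra_simps)
  also have "\<dots> \<le> norm (d + 1 - 2 * g) + (norm (g - 1))\<^sup>2"
    by (metis norm_power norm_triangle_ineq4)
  also have "\<dots> \<le> T + S\<^sup>2"
    using T S by (intro add_mono power_mono) auto
  also have "\<dots> < (1 - S)\<^sup>2"
    using TS by (simp add: power2_eq_square algebra_simps)
  also have "\<dots> \<le> (norm g)\<^sup>2"
    using g_lower \<open>S < 1\<close> by (intro power_mono) auto
  finally have "norm (d - g\<^sup>2) < (norm g)\<^sup>2" .
  moreover have "d * (1 / g)\<^sup>2 - 1 = (d - g\<^sup>2) / g\<^sup>2"
    using \<open>g \<noteq> 0\<close> by (simp add: field_simps)
  ultimately show "norm (d * (1 / g)\<^sup>2 - 1) < 1"
    using \<open>g \<noteq> 0\<close> by (simp add: norm_divide norm_power)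
qed

lemma coeff_sum_le_1_imp_class_U:
  assumes f: "normalized_series f a" and a: "coeff_sum_le a 1"
  shows "f \<in> class_U"
proof -
  have "quot_z f z \<noteq> 0 \<and> norm (deriv f z * (1 / quot_z f z)\<^sup>2 - 1) < 1"
    if z: "z \<in> unit_disc" for z
  proof -
    define r where "r = norm z"
    have r: "0 \<le> r" "r < 1" using z by (auto simp: r_def)
    define h where "h n = a (n + 2) * z ^ (n + 1)" for n
    define N where "N n = real (n + 2) * norm (a (n + 2))" for n
    have N: "summable N" "suminf N \<le> 1"
      using a by (simp_all add: coeff_sum_le_def N_def [abs_def])
    have h_sums: "h sums (quot_z f z - 1)"
      using normalized_series_quot_z_sums [OF f z] by (simp add: h_def [abs_def])
    have "(\<lambda>n. of_nat (n + 2) * h n) sums (deriv f z - 1)"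
      using normalized_series_deriv_sums [OF f z] by (simp add: h_def mult.assoc)
    then have "(\<lambda>n. of_nat (n + 2) * h n - 2 * h n)
        sums ((deriv f z - 1) - 2 * (quot_z f z - 1))"
      by (intro sums_diff sums_mult h_sums)
    then have nh_sums: "(\<lambda>n. of_nat n * h n) sums (deriv f z + 1 - 2 * quot_z f z)"
      by (simp add: algebra_simps)
    have weighted_bound: "real (n + 2) * norm (h n) \<le> r * N n" for n
    proof -
      have "r ^ (n + 1) \<le> r"
        using r by (simp add: mult_left_le power_le_one)
      then have "N n * r ^ (n + 1) \<le> N n * r"
        by (intro mult_left_mono) (auto simp: N_def)
      then show ?thesis
        by (simp add: h_def N_def norm_mult norm_power r_def mult_ac)
    qed
    have weighted: "summable (\<lambda>n. real (n + 2) * norm (h n))"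
      by (rule summable_comparison_test' [OF summable_mult [OF N(1), of r]])
         (use weighted_bound in simp)
    have S: "summable (\<lambda>n. norm (h n))"
      by (rule summable_comparison_test' [OF weighted]) (simp add: algebra_simps)
    have T: "summable (\<lambda>n. norm (of_nat n * h n))"
      by (rule summable_comparison_test' [OF weighted]) (simp add: norm_mult algebra_simps)
    have "(\<Sum>n. norm (of_nat n * h n)) + 2 * (\<Sum>n. norm (h n))
        = (\<Sum>n. norm (of_nat n * h n) + 2 * norm (h n))"
      using suminf_add [OF T summable_mult [OF S, of 2]] suminf_mult [OF S, of 2] by simp
    also have "\<dots> = (\<Sum>n. real (n + 2) * norm (h n))"
      by (simp add: norm_mult algebra_simps)
    also have "\<dots> \<le> (\<Sum>n. r * N n)"
      by (intro suminf_le weighted_bound weighted summable_mult N)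
    also have "\<dots> = r * suminf N"
      using N(1) by (rule suminf_mult)
    also have "\<dots> \<le> r"
      using r N(2) by (simp add: mult_left_le)
    also note \<open>r < 1\<close>
    finally have TS: "(\<Sum>n. norm (of_nat n * h n)) + 2 * (\<Sum>n. norm (h n)) < 1" .
    have "norm (deriv f z + 1 - 2 * quot_z f z) \<le> (\<Sum>n. norm (of_nat n * h n))"
      using summable_norm [OF T] nh_sums by (simp add: sums_iff)
    moreover have "norm (quot_z f z - 1) \<le> (\<Sum>n. norm (h n))"
      using summable_norm [OF S] h_sums by (simp add: sums_iff)
    ultimately show ?thesis
      using TS norm_div_square_minus_1_less_1 by blast
  qed
  then show ?thesis
    using f by (auto simp: class_U_def class_A_def)
qed

text \<open>
  At a critical point \<open>f'(z) (z/f(z))\<^sup>2 - 1 = -1\<close>, whatever the value of \<open>f\<close> is. Hence functions in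
  \<open>\<U>\<close> are locally injective.
\<close>
lemma class_U_imp_deriv_nonzero:
  assumes "f \<in> class_U" and "z \<in> unit_disc"
  shows "deriv f z \<noteq> 0"
  using assms by (force simp: class_U_def)

lemma coeff_sum_bound_sharp:
  fixes \<epsilon> :: real
  assumes "\<epsilon> > 0"
  obtains f a where "normalized_series f a" "coeff_sum_le a (1 + \<epsilon>)" "f \<notin> class_U"
proof -
  define b where "b = complex_of_real ((1 + \<epsilon>) / 2)"
  define f where "f z = z + b * z\<^sup>2" for z
  define a where "a n = (if n = 2 then b else 0)" for n :: nat
  have f_series: "normalized_series f a"
    unfolding normalized_series_def
  proof (intro conjI ballI)
    show "f analytic_on unit_disc"
      unfolding f_def [abs_def] by (intro analytic_intros)
    fix z :: complex
    have "(\<lambda>n. a (n + 2) * z ^ (n + 2)) sums (\<Sum>n\<in>{0}. a (n + 2) * z ^ (n + 2))"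
      by (rule sums_finite) (auto simp: a_def)
    then show "(\<lambda>n. a (n + 2) * z ^ (n + 2)) sums (f z - z)"
      by (simp add: a_def f_def power2_eq_square)
  qed
  have "(\<lambda>n. real (n + 2) * norm (a (n + 2))) sums (\<Sum>n\<in>{0}. real (n + 2) * norm (a (n + 2)))"
    by (rule sums_finite) (auto simp: a_def)
  moreover have "norm b = (1 + \<epsilon>) / 2"
    unfolding b_def norm_of_real using assms by simp
  then have "(\<Sum>n\<in>{0}. real (n + 2) * norm (a (n + 2))) = 1 + \<epsilon>"
    by (simp add: a_def)
  ultimately have "(\<lambda>n. real (n + 2) * norm (a (n + 2))) sums (1 + \<epsilon>)"
    by simp
  then have a_sum: "coeff_sum_le a (1 + \<epsilon>)"
    by (simp add: coeff_sum_le_def sums_iff)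
  define z where "z = complex_of_real (- 1 / (1 + \<epsilon>))"
  have "z \<in> unit_disc"
    unfolding z_def mem_ball_0 norm_of_real using assms by simp
  have "(f has_field_derivative 1 + 2 * b * z) (at z)"
    unfolding f_def [abs_def] by (auto intro!: derivative_eq_intros)
  moreover have "1 + 2 * b * z = 0"
  proof -
    have "2 * b * z = complex_of_real (2 * ((1 + \<epsilon>) / 2) * (- 1 / (1 + \<epsilon>)))"
      unfolding b_def z_def by (simp only: of_real_mult of_real_numeral)
    also have "2 * ((1 + \<epsilon>) / 2) * (- 1 / (1 + \<epsilon>)) = - 1"
      using assms by (simp add: field_simps)
    finally show ?thesis by simp
  qed
  ultimately have "deriv f z = 0"
    by (simp add: DERIV_imp_deriv)
  then have "f \<notin> class_U"
    using class_U_imp_deriv_nonzero \<open>z \<in> unit_disc\<close> by blast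
  with f_series a_sum show ?thesis by (rule that)
qed

theorem theorem1:
  shows "(\<forall>f a. normalized_series f a \<and> coeff_sum_le a 1 \<longrightarrow> f \<in> class_U) \<and>
         (\<forall>\<epsilon>>0. \<not> (\<forall>f a. normalized_series f a \<and> coeff_sum_le a (1 + \<epsilon>) \<longrightarrow> f \<in> class_U))"
  using coeff_sum_le_1_imp_class_U coeff_sum_bound_sharp by metis

end
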